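(* Let $n\ge 1$ and let $x,y,u_1,u_2,u_3,u_4,t,\alpha$ be commuting variables. If $xy=u_1u_2$ and $x+y=u_3+u_4$, then $$A_n^{\mathrm{cyc}}(x,y,t\,|\,\alpha)=\sum_{\sigma\in\mathfrak{S}_n}(u_1u_2)^{\mathrm{cpk}(\sigma)}u_3^{\mathrm{cda}(\sigma)}u_4^{\mathrm{cdd}(\sigma)}t^{\mathrm{fix}(\sigma)}\alpha^{\mathrm{cyc}(\sigma)}.$$
   Context: $\mathfrak{S}_n$ is the symmetric group on $[n]=\{1,\dots,n\}$. For $\sigma\in\mathfrak{S}_n$, an index $i\in[n]$ is an excedance if $i<\sigma(i)$, a drop if $i>\sigma(i)$, a fixed point if $\sigma(i)=i$; $\mathrm{exc}(\sigma),\mathrm{drop}(\sigma),\mathrm{fix}(\sigma)$ are the numbers of these and $\mathrm{cyc}(\sigma)$ is the number of cycles of $\sigma$ (fixed points included). An index $i\in[n]$ is a cycle peak if $\sigma^{-1}(i)<i>\sigma(i)$; a cycle double ascent if $\sigma^{-1}(i)<i<\sigma(i)$; a cycle double descent if $\sigma^{-1}(i)>i>\sigma(i)$; their numbers are $\mathrm{cpk}(\sigma)$, $\mathrm{cda}(\sigma)$, $\mathrm{cdd}(\sigma)$. The cycle $(\alpha,t)$-Eulerian polynomial is $$A_n^{\mathrm{cyc}}(x,y,t\,|\,\alpha)=\sum_{\sigma\in\mathfrak{S}_n}x^{\mathrm{exc}(\sigma)}y^{\mathrm{drop}(\sigma)}t^{\mathrm{fix}(\sigma)}\alpha^{\mathrm{cyc}(\sigma)}.$$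 *)

theory Defs
  imports Complex_Main "HOL-Combinatorics.Combinatorics"
begin

text \<open>
  Elements of the symmetric group on \<open>[n] = {1..n}\<close> are the functions \<open>s :: nat \<Rightarrow> nat\<close>
  with \<open>s permutes {1..n}\<close>; such an \<open>s\<close> is the identity outside \<open>[n]\<close>, so \<open>n\<close> is an explicit
  argument of every statistic and \<open>inv s\<close> is the inverse permutation.
\<close>

definition num_exc :: "nat \<Rightarrow> (nat \<Rightarrow> nat) \<Rightarrow> nat" where
  "num_exc n s = card {i \<in> {1..n}. i < s i}"

definition num_drop :: "nat \<Rightarrow> (nat \<Rightarrow> nat) \<Rightarrow> nat" where
  "num_drop n s = card {i \<in> {1..n}. i > s i}"

definition num_fix :: "nat \<Rightarrow> (nat \<Rightarrow> nat) \<Rightarrow> nat" where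
  "num_fix n s = card {i \<in> {1..n}. s i = i}"

text \<open>The cycles correspond to the distinct orbits of the points of \<open>[n]\<close>, fixed points included.\<close>

definition num_cyc :: "nat \<Rightarrow> (nat \<Rightarrow> nat) \<Rightarrow> nat" where
  "num_cyc n s = card (orbit s ` {1..n})"

definition num_cpk :: "nat \<Rightarrow> (nat \<Rightarrow> nat) \<Rightarrow> nat" where
  "num_cpk n s = card {i \<in> {1..n}. inv s i < i \<and> i > s i}"

definition num_cda :: "nat \<Rightarrow> (nat \<Rightarrow> nat) \<Rightarrow> nat" where
  "num_cda n s = card {i \<in> {1..n}. inv s i < i \<and> i < s i}"

definition num_cdd :: "nat \<Rightarrow> (nat \<Rightarrow> nat) \<Rightarrow> nat" where
  "num_cdd n s = card {i \<in> {1..n}. inv s i > i \<and> i > s i}"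

definition cyc_eulerian :: "nat \<Rightarrow> 'a \<Rightarrow> 'a \<Rightarrow> 'a \<Rightarrow> 'a \<Rightarrow> 'a::comm_ring_1" where
  "cyc_eulerian n x y t \<alpha> =
    (\<Sum>s | s permutes {1..n}.
      x ^ num_exc n s * y ^ num_drop n s * t ^ num_fix n s * \<alpha> ^ num_cyc n s)"

end

theory Submission
  imports Defs
begin

text \<open>
  A bijection argument turns excedances and drops into cycle peaks, double ascents and double
  descents: \<open>exc = cpk + cda\<close> and \<open>drop = cpk + cdd\<close> (lemmas \<open>num_exc_conv\<close> and
  \<open>num_drop_conv\<close>). Hence both sides are values of the generating polynomial
  \<open>P\<^sub>n(c, a, b, t, \<alpha>) = \<Sum>\<^sub>\<sigma> c^cpk a^cda b^cdd t^fix \<alpha>^cyc\<close>, at \<open>a = x, b = y\<close> and at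
  \<open>a = u3, b = u4\<close>, with the same \<open>c = x y = u1 u2\<close>. The content of the theorem is that \<open>P\<^sub>n\<close>
  depends on \<open>a\<close> and \<open>b\<close> only through \<open>a + b\<close>.

  To see this, build the permutations of \<open>[n + 1]\<close> from those of \<open>[n]\<close> by inserting the new
  maximum \<open>m = n + 1\<close>, either as a fixed point or into an arc \<open>i \<rightarrow> \<sigma>(i)\<close>, which becomes
  \<open>i \<rightarrow> m \<rightarrow> \<sigma>(i)\<close>. In an arc, the new maximum is a cycle peak, and exactly one
  other index changes its type. Into a rising arc, the insertion
  changes \<open>\<sigma>(i)\<close> from a double ascent to a valley or from a peak to a double descent; into a
  falling arc, it changes \<open>i\<close> from a double descent to a valley or from a peak to a double ascent;
  at a fixed point, \<open>i\<close> becomes a valley. Therefore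
  \<open>P\<^sub>n\<^sub>+\<^sub>1 = (\<alpha> t + c \<partial>\<^sub>t + c (\<partial>\<^sub>a + \<partial>\<^sub>b) + (a + b) c \<partial>\<^sub>c) P\<^sub>n\<close>,
  and this operator maps polynomials in \<open>a + b, c, t, \<alpha>\<close> to such polynomials.

  The proof works with the dual of this statement, so that no polynomial ring is needed.
  A weight \<open>W(k, p, q, f, l)\<close> on the exponents of
  \<open>c, a, b, t, \<alpha>\<close> is a linear functional on polynomials, and it kills all polynomials in
  \<open>a + b, c, t, \<alpha>\<close> iff \<open>\<Sum>\<^sub>p (m choose p) W(k, p, m - p, f, l) = 0\<close> for all \<open>k, m, f, l\<close>.
  The transpose of the operator preserves such functionals
  (\<open>binomially_null_insertion_dual\<close>), so by induction on \<open>n\<close> they all vanish on \<open>P\<^sub>n\<close>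
  (\<open>sum_weigh_stats_eq_0\<close>). The theorem is the case
  \<open>W(k, p, q, f, l) = c^k (x^p y^q - u3^p u4^q) t^f \<alpha>^l\<close>.
\<close>

section \<open>Inserting a new point into a cycle\<close>

text \<open>
  The arc \<open>i \<rightarrow> s i\<close> is replaced by the path \<open>i \<rightarrow> a \<rightarrow> s i\<close>. If \<open>i = a\<close> and \<open>s a = a\<close>, the
  result is \<open>s\<close> itself, so that adding \<open>a\<close> as a fixed point is the instance \<open>i = a\<close>.
\<close>
definition insert_after :: "'a \<Rightarrow> 'a \<Rightarrow> ('a \<Rightarrow> 'a) \<Rightarrow> 'a \<Rightarrow> 'a" where
  "insert_after a i s = s(i := a, a := s i)"

lemma insert_after_eq_transpose:
  assumes "s permutes S" "a \<notin> S"
  shows "transpose a (s i) \<circ> s = insert_after a i s"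
proof
  fix j
  have sa: "s a = a" using assms by (simp add: permutes_not_in)
  have inj: "s j = s k \<longleftrightarrow> j = k" for k
    using permutes_inj[OF assms(1)] by (simp add: inj_eq)
  show "(transpose a (s i) \<circ> s) j = insert_after a i s j"
  proof (cases "j = a")
    case True
    then show ?thesis using sa by (simp add: insert_after_def)
  next
    case False
    then have "s j \<noteq> a" using inj[of a] sa by simp
    then show ?thesis using False inj[of i] by (simp add: insert_after_def transpose_def)
  qed
qed

lemma insert_after_permutes:
  assumes "s permutes S" "a \<notin> S" "i \<in> insert a S"
  shows "insert_after a i s permutes insert a S"
proof -
  have "s permutes insert a S"
    using assms(1) by (rule permutes_subset) auto
  moreover from this have "s i \<in> insert a S"
    using assms(3) permutes_in_image by metis
  ultimately have "transpose a (s i) \<circ> s permutes insert a S"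
    by (intro permutes_compose permutes_swap_id) auto
  then show ?thesis
    by (simp add: insert_after_eq_transpose[OF assms(1,2)])
qed

lemma inv_insert_after:
  assumes s: "s permutes S" and a: "a \<notin> S" and i: "i \<in> insert a S"
  shows "inv (insert_after a i s) = (inv s)(s i := a, a := i)"
proof
  fix j
  let ?s' = "insert_after a i s"
  have inj: "inj ?s'"
    using insert_after_permutes[OF assms] by (rule permutes_inj)
  have sa: "s a = a" using s a by (simp add: permutes_not_in)
  have 1: "s (inv s j) = j" for j using s by (rule permutes_inverses)
  have 2: "inv s (s j) = j" for j using s by (rule permutes_inverses)
  have "?s' (((inv s)(s i := a, a := i)) j) = j"
    using sa 1[of j] 2[of i] 2[of a] by (auto simp: insert_after_def)
  then show "inv ?s' j = ((inv s)(s i := a, a := i)) j"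
    using inj by (metis inv_f_f)
qed

text \<open>
  Removing \<open>a\<close> from its cycle is inverse to insertion, so each permutation of the larger set arises
  exactly once. In \<open>sum_over_permutations_insert\<close> the parameter is the successor \<open>b = s i\<close> of the new point;
  the sum over \<open>b\<close> is reindexed by \<open>s\<close> itself.
\<close>
lemma sum_permutations_insert_after:
  fixes g :: "('a \<Rightarrow> 'a) \<Rightarrow> 'b::comm_monoid_add"
  assumes fin: "finite S" and a: "a \<notin> S"
  shows "(\<Sum>s | s permutes insert a S. g s)
    = (\<Sum>s | s permutes S. \<Sum>i\<in>insert a S. g (insert_after a i s))"
proof -
  have "(\<Sum>s | s permutes insert a S. g s)
      = (\<Sum>b\<in>insert a S. \<Sum>s | s permutes S. g (transpose a b \<circ> s))"
    using sum_over_permutations_insert[OF fin a] .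
  also have "\<dots> = (\<Sum>s | s permutes S. \<Sum>b\<in>insert a S. g (transpose a b \<circ> s))"
    by (rule sum.swap)
  also have "\<dots> = (\<Sum>s | s permutes S. \<Sum>i\<in>insert a S. g (insert_after a i s))"
  proof (rule sum.cong[OF refl])
    fix s assume "s \<in> {s. s permutes S}"
    then have s: "s permutes S" by simp
    then have "s permutes insert a S" by (rule permutes_subset) auto
    from sum.permute[OF this, of "\<lambda>b. g (transpose a b \<circ> s)"]
    show "(\<Sum>b\<in>insert a S. g (transpose a b \<circ> s)) = (\<Sum>i\<in>insert a S. g (insert_after a i s))"
      by (simp only: o_def[of "\<lambda>b. g (transpose a b \<circ> s)"] insert_after_eq_transpose[OF s a])
  qed
  finally show ?thesis .
qed

text \<open>
  Exactly the cycle that contains the subdivided arc gains the point \<open>a\<close>.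
\<close>
lemma orbit_insert_after:
  assumes s: "s permutes S" and a: "a \<notin> S" and i: "i \<in> S" and j: "j \<in> S"
  shows "orbit (insert_after a i s) j = (if s i \<in> orbit s j then insert a (orbit s j) else orbit s j)"
    (is "orbit ?s' j = _")
proof -
  have inj: "s k = s l \<longleftrightarrow> k = l" for k l
    using permutes_inj[OF s] by (simp add: inj_eq)
  have "s a = a" using s a by (simp add: permutes_not_in)
  have new_a[simp]: "?s' a = s i" and new_i[simp]: "?s' i = a" using a i by (auto simp: insert_after_def)
  have S: "y \<in> S" if "y \<in> orbit s j" for y
    using that j permutes_orbit_subset[OF s] by auto
  have other: "?s' k = s k" if "k \<in> S" "k \<noteq> i" for k
    using that a by (auto simp: insert_after_def)
  \<comment> \<open>An old arc is followed either directly or, at \<open>i\<close>, by the detour through \<open>a\<close>.\<close>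
  have step: "s k \<in> orbit ?s' j" if "k \<in> S" and "?s' k \<in> orbit ?s' j" for k
  proof (cases "k = i")
    case True
    then show ?thesis using that orbit.step[of a ?s' j] by simp
  next
    case False
    then show ?thesis using that other by simp
  qed
  have sub: "y \<in> orbit ?s' j" if "y \<in> orbit s j" for y
    using that
  proof induction
    case base
    then show ?case using step j by (simp add: orbit.base)
  next
    case (step y)
    then show ?case using \<open>\<And>k. _ \<Longrightarrow> _ \<Longrightarrow> s k \<in> orbit ?s' j\<close> S by (simp add: orbit.step)
  qed
  have sup: "y \<in> orbit s j \<or> y = a \<and> s i \<in> orbit s j" if "y \<in> orbit ?s' j" for y
    using that
  proof induction
    case base
    then show ?case using j other by (cases "j = i") (auto intro: orbit.base)
  next
    case (step y)
    then show ?case using S other by (cases "y = i") (auto intro: orbit.step)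
  qed
  have new: "a \<in> orbit ?s' j" if "s i \<in> orbit s j"
    using that
  proof cases
    case base
    then have "i = j" using inj by blast
    then show ?thesis using new_i orbit.base[of ?s' j] by metis
  next
    case (step y)
    then have "i = y" using inj by blast
    then show ?thesis using step(2) new_i sub[of y] orbit.step[of y ?s' j] by metis
  qed
  show ?thesis using sub sup new by auto
qed

text \<open>
  The orbit of the new point is that of \<open>i\<close>, and the old orbits change by an injective map \<open>g\<close>, so
  their number stays the same.
\<close>
lemma num_cyc_insert_after:
  assumes s: "s permutes {1..n}" and i: "i \<in> {1..n}"
  shows "num_cyc (Suc n) (insert_after (Suc n) i s) = num_cyc n s"
proof -
  let ?a = "Suc n" and ?s' = "insert_after (Suc n) i s"
  define g where "g X = (if s i \<in> X then insert ?a X else X)" for X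
  have a: "?a \<notin> {1..n}" by simp
  have orb: "orbit ?s' j = g (orbit s j)" if "j \<in> {1..n}" for j
    using orbit_insert_after[OF s a i that] by (simp add: g_def)
  have sub: "orbit s j \<subseteq> {1..n}" if "j \<in> {1..n}" for j
    using permutes_orbit_subset[OF s that] .
  have perm: "permutation ?s'"
    using insert_after_permutes[OF s a] i by (auto simp: permutation_permutes)
  have "?s' i = ?a" using i by (auto simp: insert_after_def)
  then have "?a \<in> orbit ?s' i" using orbit.base[of ?s' i] by simp
  then have "orbit ?s' ?a = orbit ?s' i"
    using perm by (intro orbit_cyclic_eq3[OF cyclic_on_orbit'])
  then have "orbit ?s' ` {1..Suc n} = orbit ?s' ` {1..n}"
    using i by (auto simp: atLeastAtMostSuc_conv)
  also have "\<dots> = g ` orbit s ` {1..n}"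
    unfolding image_image using orb by (intro image_cong) auto
  finally have eq: "orbit ?s' ` {1..Suc n} = g ` orbit s ` {1..n}" .
  have "inj_on g (Pow {1..n})"
  proof (rule inj_on_inverseI)
    fix X assume "X \<in> Pow {1..n}"
    then show "g X - {?a} = X" by (auto simp: g_def)
  qed
  then have "inj_on g (orbit s ` {1..n})"
    by (rule inj_on_subset) (use sub in blast)
  then show ?thesis unfolding num_cyc_def eq by (rule card_image)
qed

lemma num_cyc_new_fixed_point:
  assumes s: "s permutes {1..n}"
  shows "num_cyc (Suc n) s = Suc (num_cyc n s)"
proof -
  have "s (Suc n) = Suc n" using s by (simp add: permutes_not_in)
  then have "orbit s (Suc n) = {Suc n}" by (simp add: orbit_eq_singleton_iff)
  moreover have "orbit s j \<subseteq> {1..n}" if "j \<in> {1..n}" for j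
    using permutes_orbit_subset[OF s that] .
  then have "Suc n \<notin> orbit s j" if "j \<in> {1..n}" for j
    using that by fastforce
  then have "{Suc n} \<notin> orbit s ` {1..n}" by blast
  ultimately show ?thesis
    by (simp add: num_cyc_def atLeastAtMostSuc_conv)
qed

section \<open>The effect of an insertion on the statistics\<close>

definition weigh_stats ::
  "(nat \<Rightarrow> nat \<Rightarrow> nat \<Rightarrow> nat \<Rightarrow> nat \<Rightarrow> 'b) \<Rightarrow> nat \<Rightarrow> (nat \<Rightarrow> nat) \<Rightarrow> 'b" where
  "weigh_stats W n s = W (num_cpk n s) (num_cda n s) (num_cdd n s) (num_fix n s) (num_cyc n s)"

text \<open>
  The transpose of the operator \<open>\<alpha> t + c \<partial>\<^sub>t + c \<partial>\<^sub>a + c \<partial>\<^sub>b + (a + b) c \<partial>\<^sub>c\<close>, acting on functionals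
  given by their values on the monomials \<open>c^k a^p b^q t^f \<alpha>^l\<close>. Where \<open>f\<close>, \<open>p\<close> or \<open>q\<close> is \<open>0\<close>, the
  truncated subtraction is harmless because its term has the factor \<open>0\<close>.
\<close>
definition insertion_dual ::
  "(nat \<Rightarrow> nat \<Rightarrow> nat \<Rightarrow> nat \<Rightarrow> nat \<Rightarrow> 'b::comm_semiring_1) \<Rightarrow> nat \<Rightarrow> nat \<Rightarrow> nat \<Rightarrow> nat \<Rightarrow> nat \<Rightarrow> 'b" where
  "insertion_dual W k p q f l =
     W k p q (f + 1) (l + 1)
     + of_nat f * W (k + 1) p q (f - 1) l
     + of_nat p * W (k + 1) (p - 1) q f l
     + of_nat q * W (k + 1) p (q - 1) f l
     + of_nat k * (W k (p + 1) q f l + W k p (q + 1) f l)"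

context
  fixes n :: nat and s :: "nat \<Rightarrow> nat"
  assumes s: "s permutes {1..n}"
begin

lemma inv_insert_max:
  assumes "i \<in> {1..n}"
  shows "inv (insert_after (Suc n) i s) = (inv s)(s i := Suc n, Suc n := i)"
  by (rule inv_insert_after[OF s]) (use assms in auto)

lemma weigh_insert_new_fixed_point:
  "weigh_stats W (Suc n) (insert_after (Suc n) (Suc n) s)
    = W (num_cpk n s) (num_cda n s) (num_cdd n s) (num_fix n s + 1) (num_cyc n s + 1)"
proof -
  have m: "s (Suc n) = Suc n" "inv s (Suc n) = Suc n"
    using s permutes_inv[OF s] by (simp_all add: permutes_not_in)
  have "{i \<in> {1..Suc n}. s i = i} = insert (Suc n) {i \<in> {1..n}. s i = i}"
    using m by (auto simp: le_Suc_eq)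
  then have "num_fix (Suc n) s = num_fix n s + 1" by (simp add: num_fix_def)
  moreover have "num_cpk (Suc n) s = num_cpk n s" "num_cda (Suc n) s = num_cda n s"
      "num_cdd (Suc n) s = num_cdd n s"
    unfolding num_cpk_def num_cda_def num_cdd_def
    using m by (auto intro!: arg_cong[where f = card] simp: le_Suc_eq)
  moreover have "insert_after (Suc n) (Suc n) s = s"
    using m by (auto simp: insert_after_def)
  ultimately show ?thesis
    using num_cyc_new_fixed_point[OF s] by (simp add: weigh_stats_def)
qed

text \<open>
  Since \<open>Suc n\<close> exceeds everything else, \<open>i\<close> is now followed by a larger value and \<open>s i\<close> preceded by
  one; no other old index sees a change. So only an end of the arc that used to see a smaller
  neighbour along it changes its type: \<open>s i\<close> for a rising arc, \<open>i\<close> for a falling one; a fixed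
  point turns into a valley. Valleys are not counted, so an index that becomes one just leaves its
  old set.
\<close>
lemma weigh_insert_after:
  fixes i
  assumes i: "i \<in> {1..n}"
  defines "s' \<equiv> insert_after (Suc n) i s"
  shows weigh_insert_after_fixed_point:
      "s i = i \<Longrightarrow> weigh_stats W (Suc n) s'
        = W (num_cpk n s + 1) (num_cda n s) (num_cdd n s) (num_fix n s - 1) (num_cyc n s)"
    and weigh_insert_before_double_ascent:
      "i < s i \<Longrightarrow> s i < s (s i) \<Longrightarrow> weigh_stats W (Suc n) s'
        = W (num_cpk n s + 1) (num_cda n s - 1) (num_cdd n s) (num_fix n s) (num_cyc n s)"
    and weigh_insert_before_peak:
      "i < s i \<Longrightarrow> s (s i) < s i \<Longrightarrow> weigh_stats W (Suc n) s'
        = W (num_cpk n s) (num_cda n s) (num_cdd n s + 1) (num_fix n s) (num_cyc n s)"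
    and weigh_insert_after_double_descent:
      "s i < i \<Longrightarrow> i < inv s i \<Longrightarrow> weigh_stats W (Suc n) s'
        = W (num_cpk n s + 1) (num_cda n s) (num_cdd n s - 1) (num_fix n s) (num_cyc n s)"
    and weigh_insert_after_peak:
      "s i < i \<Longrightarrow> inv s i < i \<Longrightarrow> weigh_stats W (Suc n) s'
        = W (num_cpk n s) (num_cda n s + 1) (num_cdd n s) (num_fix n s) (num_cyc n s)"
proof -
  let ?m = "Suc n" and ?b = "s i"
  let ?PK = "\<lambda>n s. {j \<in> {1..n}. inv s j < j \<and> j > s j}"
  let ?DA = "\<lambda>n s. {j \<in> {1..n}. inv s j < j \<and> j < s j}"
  let ?DD = "\<lambda>n s. {j \<in> {1..n}. inv s j > j \<and> j > s j}"
  let ?FX = "\<lambda>n s. {j \<in> {1..n}. s j = j}"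
  have b: "?b \<in> {1..n}" using i permutes_in_image[OF s] by blast
  have s': "s' j = (if j = ?m then ?b else if j = i then ?m else s j)" for j
    by (simp add: s'_def insert_after_def)
  have t': "inv s' j = (if j = ?m then i else if j = ?b then ?m else inv s j)" for j
    unfolding s'_def inv_insert_max[OF i] by simp
  have [simp]: "inv s ?b = i" using s by (simp add: permutes_inverses)
  have inv_fix: "inv s j = j \<longleftrightarrow> s j = j" for j
    using s by (metis permutes_inverses)
  have m: "j \<in> {1..?m} \<longleftrightarrow> j = ?m \<or> j \<in> {1..n}" for j by auto
  have cyc: "num_cyc ?m s' = num_cyc n s"
    unfolding s'_def by (rule num_cyc_insert_after[OF s i])
  note count = weigh_stats_def num_cpk_def num_cda_def num_cdd_def num_fix_def
  note upd = s' t' m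
  {
    assume *: "s i = i"
    have "?PK ?m s' = insert ?m (?PK n s)" "?DA ?m s' = ?DA n s" "?DD ?m s' = ?DD n s"
        "?FX ?m s' = ?FX n s - {i}" "i \<in> ?FX n s"
      using * i b inv_fix unfolding upd by (auto split: if_splits)
    then show "weigh_stats W ?m s' = W (num_cpk n s + 1) (num_cda n s) (num_cdd n s)
        (num_fix n s - 1) (num_cyc n s)"
      unfolding count cyc by simp
  next
    assume *: "i < ?b" "?b < s ?b"
    have "?PK ?m s' = insert ?m (?PK n s)" "?DA ?m s' = ?DA n s - {?b}" "?DD ?m s' = ?DD n s"
        "?FX ?m s' = ?FX n s" "?b \<in> ?DA n s"
      using * i b unfolding upd by (auto split: if_splits)
    then show "weigh_stats W ?m s' = W (num_cpk n s + 1) (num_cda n s - 1) (num_cdd n s)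
        (num_fix n s) (num_cyc n s)"
      unfolding count cyc by simp
  next
    assume *: "i < ?b" "s ?b < ?b"
    have "?PK ?m s' = insert ?m (?PK n s - {?b})" "?DA ?m s' = ?DA n s"
        "?DD ?m s' = insert ?b (?DD n s)" "?FX ?m s' = ?FX n s"
        "?b \<in> ?PK n s" "?b \<notin> ?DD n s"
      using * i b unfolding upd by (auto split: if_splits)
    moreover from this(5) have "?PK n s \<noteq> {}" by blast
    then have "0 < card (?PK n s)" by (simp only: card_gt_0_iff) simp
    ultimately show "weigh_stats W ?m s' = W (num_cpk n s) (num_cda n s) (num_cdd n s + 1)
        (num_fix n s) (num_cyc n s)"
      unfolding count cyc by simp
  next
    assume *: "?b < i" "i < inv s i"
    have "?PK ?m s' = insert ?m (?PK n s)" "?DA ?m s' = ?DA n s" "?DD ?m s' = ?DD n s - {i}"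
        "?FX ?m s' = ?FX n s" "i \<in> ?DD n s"
      using * i b unfolding upd by (auto split: if_splits)
    then show "weigh_stats W ?m s' = W (num_cpk n s + 1) (num_cda n s) (num_cdd n s - 1)
        (num_fix n s) (num_cyc n s)"
      unfolding count cyc by simp
  next
    assume *: "?b < i" "inv s i < i"
    have "?PK ?m s' = insert ?m (?PK n s - {i})" "?DA ?m s' = insert i (?DA n s)"
        "?DD ?m s' = ?DD n s" "?FX ?m s' = ?FX n s"
        "i \<in> ?PK n s" "i \<notin> ?DA n s"
      using * i b unfolding upd by (auto split: if_splits)
    moreover from this(5) have "?PK n s \<noteq> {}" by blast
    then have "0 < card (?PK n s)" by (simp only: card_gt_0_iff) simp
    ultimately show "weigh_stats W ?m s' = W (num_cpk n s) (num_cda n s + 1) (num_cdd n s)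
        (num_fix n s) (num_cyc n s)"
      unfolding count cyc by simp
  }
qed

text \<open>
  The places of insertion are sorted by the index whose type changes. For rising arcs this is the
  head \<open>s i\<close>, which runs through the peaks and double ascents; for falling arcs it is the tail \<open>i\<close>,
  which runs through the peaks and double descents. Peaks are thus hit twice, once towards each kind
  of double index, and this is where the factor \<open>a + b\<close> of \<open>c \<partial>\<^sub>c\<close> comes from.
\<close>
lemma sum_weigh_insert_after:
  fixes W :: "nat \<Rightarrow> nat \<Rightarrow> nat \<Rightarrow> nat \<Rightarrow> nat \<Rightarrow> 'b::comm_semiring_1"
  shows "(\<Sum>i\<in>{1..Suc n}. weigh_stats W (Suc n) (insert_after (Suc n) i s))
    = weigh_stats (insertion_dual W) n s"
proof -
  let ?w = "\<lambda>i. weigh_stats W (Suc n) (insert_after (Suc n) i s)"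
  let ?k = "num_cpk n s" and ?p = "num_cda n s" and ?q = "num_cdd n s"
    and ?f = "num_fix n s" and ?l = "num_cyc n s"
  let ?I = "{1..n}"
  let ?PK = "{j \<in> ?I. inv s j < j \<and> j > s j}"
  let ?DA = "{j \<in> ?I. inv s j < j \<and> j < s j}"
  let ?DD = "{j \<in> ?I. inv s j > j \<and> j > s j}"
  let ?FX = "{j \<in> ?I. s j = j}"
  let ?E = "{j \<in> ?I. j < s j}" and ?D = "{j \<in> ?I. s j < j}"
  have inv: "inv s (s j) = j" "s (inv s j) = j" for j
    using s by (simp_all add: permutes_inverses)
  have mem: "s j \<in> ?I \<longleftrightarrow> j \<in> ?I" "inv s j \<in> ?I \<longleftrightarrow> j \<in> ?I" for j
    using permutes_in_image[OF s] permutes_in_image[OF permutes_inv[OF s]] by blast+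
  have inv_fix: "inv s j = j \<longleftrightarrow> s j = j" for j
    using inv by metis
  \<comment> \<open>Rising arcs, indexed by their heads.\<close>
  have "sum ?w ?E = (\<Sum>j\<in>?PK \<union> ?DA. ?w (inv s j))"
    by (rule sum.reindex_bij_witness[of _ "inv s" s])
      (use inv mem inv_fix in \<open>auto simp del: atLeastAtMost_iff\<close>, metis less_irrefl linorder_neqE_nat)
  also have "\<dots> = (\<Sum>j\<in>?PK. ?w (inv s j)) + (\<Sum>j\<in>?DA. ?w (inv s j))"
    by (rule sum.union_disjoint) auto
  also have "(\<Sum>j\<in>?PK. ?w (inv s j)) = (\<Sum>j\<in>?PK. W ?k ?p (?q + 1) ?f ?l)"
  proof (rule sum.cong[OF refl])
    fix j assume "j \<in> ?PK"
    then show "?w (inv s j) = W ?k ?p (?q + 1) ?f ?l"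
      using weigh_insert_before_peak[of "inv s j" W] mem inv by auto
  qed
  also have "(\<Sum>j\<in>?DA. ?w (inv s j)) = (\<Sum>j\<in>?DA. W (?k + 1) (?p - 1) ?q ?f ?l)"
  proof (rule sum.cong[OF refl])
    fix j assume "j \<in> ?DA"
    then show "?w (inv s j) = W (?k + 1) (?p - 1) ?q ?f ?l"
      using weigh_insert_before_double_ascent[of "inv s j" W] mem inv by auto
  qed
  finally have E: "sum ?w ?E = of_nat ?k * W ?k ?p (?q + 1) ?f ?l
      + of_nat ?p * W (?k + 1) (?p - 1) ?q ?f ?l"
    by (simp add: num_cpk_def num_cda_def)
  \<comment> \<open>Falling arcs, indexed by their tails.\<close>
  have "inv s j < j \<or> j < inv s j" if "s j < j" for j
    using inv_fix[of j] that by auto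
  then have "?D = ?PK \<union> ?DD" by blast
  then have "sum ?w ?D = sum ?w ?PK + sum ?w ?DD"
    by (simp add: sum.union_disjoint disjoint_iff)
  also have "sum ?w ?PK = (\<Sum>j\<in>?PK. W ?k (?p + 1) ?q ?f ?l)"
    by (rule sum.cong[OF refl]) (rule weigh_insert_after_peak; simp)
  also have "sum ?w ?DD = (\<Sum>j\<in>?DD. W (?k + 1) ?p (?q - 1) ?f ?l)"
    by (rule sum.cong[OF refl]) (rule weigh_insert_after_double_descent; simp)
  finally have D: "sum ?w ?D = of_nat ?k * W ?k (?p + 1) ?q ?f ?l
      + of_nat ?q * W (?k + 1) ?p (?q - 1) ?f ?l"
    by (simp add: num_cpk_def num_cdd_def)
  have "sum ?w ?FX = (\<Sum>j\<in>?FX. W (?k + 1) ?p ?q (?f - 1) ?l)"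
    by (rule sum.cong[OF refl]) (rule weigh_insert_after_fixed_point; simp)
  then have F: "sum ?w ?FX = of_nat ?f * W (?k + 1) ?p ?q (?f - 1) ?l"
    by (simp add: num_fix_def)
  have "?I = ?FX \<union> (?E \<union> ?D)" by auto
  then have "sum ?w ?I = sum ?w (?FX \<union> (?E \<union> ?D))" by (rule arg_cong)
  also have "\<dots> = sum ?w ?FX + sum ?w (?E \<union> ?D)"
    by (rule sum.union_disjoint) auto
  also have "sum ?w (?E \<union> ?D) = sum ?w ?E + sum ?w ?D"
    by (rule sum.union_disjoint) auto
  finally have I: "sum ?w ?I = sum ?w ?FX + (sum ?w ?E + sum ?w ?D)" .
  have "sum ?w {1..Suc n} = ?w (Suc n) + sum ?w ?I"
    by (simp add: add.commute)
  also have "\<dots> = weigh_stats (insertion_dual W) n s"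
    unfolding I E D F weigh_insert_new_fixed_point
    by (simp add: weigh_stats_def insertion_dual_def algebra_simps)
  finally show ?thesis .
qed

end

section \<open>Functionals that vanish on polynomials in the sum of two variables\<close>

text \<open>
  Expanding \<open>c^k (a + b)^m t^f \<alpha>^l\<close> by the binomial theorem shows that these are the functionals
  that vanish on all polynomials in \<open>c, a + b, t, \<alpha>\<close>.
\<close>
definition binomially_null ::
  "(nat \<Rightarrow> nat \<Rightarrow> nat \<Rightarrow> nat \<Rightarrow> nat \<Rightarrow> 'b::comm_semiring_1) \<Rightarrow> bool" where
  "binomially_null W \<longleftrightarrow>
    (\<forall>k m f l. (\<Sum>p\<le>m. of_nat (m choose p) * W k p (m - p) f l) = 0)"

text \<open>
  The dual form of \<open>\<partial>\<^sub>a (a + b)^(m + 1) = (m + 1) (a + b)^m\<close>.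
\<close>
lemma sum_choose_absorb:
  fixes g :: "nat \<Rightarrow> nat \<Rightarrow> 'b::comm_semiring_1"
  shows "(\<Sum>p\<le>Suc m. of_nat (Suc m choose p) * (of_nat p * g (p - 1) (Suc m - p)))
    = of_nat (Suc m) * (\<Sum>p\<le>m. of_nat (m choose p) * g p (m - p))"
proof -
  have "(\<Sum>p\<le>Suc m. of_nat (Suc m choose p) * (of_nat p * g (p - 1) (Suc m - p)))
     = (\<Sum>p\<le>m. of_nat (Suc m choose Suc p) * (of_nat (Suc p) * g p (m - p)))"
    by (subst sum.atMost_Suc_shift) simp
  also have "\<dots> = (\<Sum>p\<le>m. of_nat (Suc m) * (of_nat (m choose p) * g p (m - p)))"
  proof (rule sum.cong[OF refl])
    fix p
    have "of_nat (Suc m choose Suc p) * (of_nat (Suc p) * g p (m - p))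
        = (of_nat (Suc p * (Suc m choose Suc p)) :: 'b) * g p (m - p)"
      unfolding of_nat_mult by (simp only: ac_simps)
    also have "\<dots> = of_nat (Suc m) * (of_nat (m choose p) * g p (m - p))"
      unfolding Suc_times_binomial_eq by (simp only: of_nat_mult ac_simps Suc_times_binomial)
    finally show "of_nat (Suc m choose Suc p) * (of_nat (Suc p) * g p (m - p))
        = of_nat (Suc m) * (of_nat (m choose p) * g p (m - p))" .
  qed
  finally show ?thesis by (simp only: sum_distrib_left)
qed

lemma sum_choose_flip:
  fixes g :: "nat \<Rightarrow> nat \<Rightarrow> 'b::comm_semiring_1"
  shows "(\<Sum>p\<le>m. of_nat (m choose p) * g p (m - p)) = (\<Sum>p\<le>m. of_nat (m choose p) * g (m - p) p)"
  by (rule sum.reindex_bij_witness[of _ "\<lambda>p. m - p" "\<lambda>p. m - p"])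
    (auto simp: binomial_symmetric[symmetric])

text \<open>
  The dual form of \<open>(a + b) (a + b)^m = (a + b)^(m + 1)\<close>.
\<close>
lemma sum_choose_Pascal:
  fixes g :: "nat \<Rightarrow> nat \<Rightarrow> 'b::comm_semiring_1"
  shows "(\<Sum>p\<le>m. of_nat (m choose p) * (g (p + 1) (m - p) + g p (m - p + 1)))
    = (\<Sum>p\<le>Suc m. of_nat (Suc m choose p) * g p (Suc m - p))"
proof -
  have "(\<Sum>p\<le>Suc m. of_nat (Suc m choose p) * g p (Suc m - p))
      = g 0 (Suc m) + (\<Sum>p\<le>m. of_nat (m choose Suc p) * g (Suc p) (m - p))
        + (\<Sum>p\<le>m. of_nat (m choose p) * g (Suc p) (m - p))"
    by (subst sum.atMost_Suc_shift) (simp add: algebra_simps sum.distrib)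
  also have "g 0 (Suc m) + (\<Sum>p\<le>m. of_nat (m choose Suc p) * g (Suc p) (m - p))
      = (\<Sum>p\<le>Suc m. of_nat (m choose p) * g p (Suc m - p))"
    by (subst sum.atMost_Suc_shift) simp
  also have "\<dots> = (\<Sum>p\<le>m. of_nat (m choose p) * g p (m - p + 1))"
    by (simp add: Suc_diff_le binomial_eq_0)
  finally show ?thesis by (simp add: algebra_simps sum.distrib)
qed

text \<open>
  Each term of the transposed operator preserves the property on its own: the derivatives \<open>\<partial>\<^sub>a\<close>,
  \<open>\<partial>\<^sub>b\<close> by absorption, multiplication by \<open>a + b\<close> by Pascal's rule, and the other two terms because
  they do not touch the exponents \<open>p\<close> and \<open>q\<close>.
\<close>
lemma binomially_null_insertion_dual:
  assumes W: "binomially_null W"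
  shows "binomially_null (insertion_dual W)"
  unfolding binomially_null_def
proof (intro allI)
  fix k m f l
  have null: "(\<Sum>p\<le>m. of_nat (m choose p) * W k p (m - p) f l) = 0" for k m f l
    using W by (simp add: binomially_null_def)
  let ?S = "\<lambda>h. \<Sum>p\<le>m. of_nat (m choose p) * h p (m - p)"
  have asc: "?S (\<lambda>p q. of_nat p * W (k + 1) (p - 1) q f l) = 0"
  proof (cases m)
    case (Suc m')
    then show ?thesis using sum_choose_absorb[of m' "\<lambda>p q. W (k + 1) p q f l"] null by simp
  qed simp
  have desc: "?S (\<lambda>p q. of_nat q * W (k + 1) p (q - 1) f l) = 0"
  proof (cases m)
    case (Suc m')
    have "?S (\<lambda>p q. of_nat q * W (k + 1) p (q - 1) f l)
        = ?S (\<lambda>q p. of_nat q * W (k + 1) p (q - 1) f l)"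
      by (rule sum_choose_flip)
    also have "\<dots> = of_nat (Suc m') * (\<Sum>q\<le>m'. of_nat (m' choose q) * W (k + 1) (m' - q) q f l)"
      unfolding Suc by (rule sum_choose_absorb[of m' "\<lambda>q p. W (k + 1) p q f l"])
    also have "(\<Sum>q\<le>m'. of_nat (m' choose q) * W (k + 1) (m' - q) q f l) = 0"
      using sum_choose_flip[of m' "\<lambda>p q. W (k + 1) p q f l"] null by simp
    finally show ?thesis by simp
  qed simp
  have "?S (\<lambda>p q. W k (p + 1) q f l + W k p (q + 1) f l) = 0"
    using sum_choose_Pascal[of m "\<lambda>p q. W k p q f l"] null by simp
  then have pk: "?S (\<lambda>p q. of_nat k * (W k (p + 1) q f l + W k p (q + 1) f l)) = 0"
    by (simp add: mult.left_commute[of _ "of_nat k"] flip: sum_distrib_left)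
  have fx: "?S (\<lambda>p q. of_nat f * W (k + 1) p q (f - 1) l) = 0"
    using null by (simp add: mult.left_commute[of _ "of_nat f"] flip: sum_distrib_left)
  have "?S (\<lambda>p q. insertion_dual W k p q f l)
      = ?S (\<lambda>p q. W k p q (f + 1) (l + 1))
        + ?S (\<lambda>p q. of_nat f * W (k + 1) p q (f - 1) l)
        + ?S (\<lambda>p q. of_nat p * W (k + 1) (p - 1) q f l)
        + ?S (\<lambda>p q. of_nat q * W (k + 1) p (q - 1) f l)
        + ?S (\<lambda>p q. of_nat k * (W k (p + 1) q f l + W k p (q + 1) f l))"
    by (simp only: insertion_dual_def distrib_left sum.distrib)
  then show "?S (\<lambda>p q. insertion_dual W k p q f l) = 0"
    unfolding null fx asc desc pk by simp
qed

lemma sum_weigh_stats_eq_0: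
  assumes "binomially_null W"
  shows "(\<Sum>s | s permutes {1..n}. weigh_stats W n s) = 0"
  using assms
proof (induction n arbitrary: W)
  case 0
  have "(\<Sum>p\<le>0. of_nat (0 choose p) * W 0 p (0 - p) 0 0) = 0"
    using 0 unfolding binomially_null_def by blast
  then have "W 0 0 0 0 0 = 0" by simp
  then show ?case
    by (simp add: weigh_stats_def num_cpk_def num_cda_def num_cdd_def num_fix_def num_cyc_def)
next
  case (Suc n)
  have "{1..Suc n} = insert (Suc n) {1..n}" by auto
  then have "(\<Sum>s | s permutes {1..Suc n}. weigh_stats W (Suc n) s)
      = (\<Sum>s | s permutes {1..n}. \<Sum>i\<in>{1..Suc n}. weigh_stats W (Suc n) (insert_after (Suc n) i s))"
    using sum_permutations_insert_after[of "{1..n}" "Suc n" "weigh_stats W (Suc n)"] by simp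
  also have "\<dots> = (\<Sum>s | s permutes {1..n}. weigh_stats (insertion_dual W) n s)"
    by (intro sum.cong refl sum_weigh_insert_after) simp
  also have "\<dots> = 0"
    by (rule Suc.IH[OF binomially_null_insertion_dual[OF Suc.prems]])
  finally show ?case .
qed

section \<open>Excedances and drops in terms of peaks\<close>

text \<open>
  The permutation \<open>s\<close> maps the tails \<open>i < s i\<close> of the rising arcs to their heads, and such a head is
  a peak or a double ascent.
\<close>
lemma num_exc_conv:
  assumes s: "s permutes {1..n}"
  shows "num_exc n s = num_cpk n s + num_cda n s"
proof -
  have inv: "inv s (s j) = j" "s (inv s j) = j" for j
    using s by (simp_all add: permutes_inverses)
  have mem: "s j \<in> {1..n} \<longleftrightarrow> j \<in> {1..n}" "inv s j \<in> {1..n} \<longleftrightarrow> j \<in> {1..n}" for j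
    using permutes_in_image[OF s] permutes_in_image[OF permutes_inv[OF s]] by blast+
  have ne: "s j < j \<or> j < s j" if "inv s j < j" for j
    using inv(1)[of j] that by (cases "s j = j") auto
  have "bij_betw s {i \<in> {1..n}. i < s i} {i \<in> {1..n}. inv s i < i}"
    by (rule bij_betwI[of _ _ _ "inv s"]) (use inv mem in \<open>auto simp del: atLeastAtMost_iff\<close>)
  then have "num_exc n s = card {i \<in> {1..n}. inv s i < i}"
    unfolding num_exc_def by (rule bij_betw_same_card)
  also have "{i \<in> {1..n}. inv s i < i}
      = {i \<in> {1..n}. inv s i < i \<and> i > s i} \<union> {i \<in> {1..n}. inv s i < i \<and> i < s i}"
    using ne by blast
  also have "card \<dots> = num_cpk n s + num_cda n s"
    unfolding num_cpk_def num_cda_def by (rule card_Un_disjoint) auto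
  finally show ?thesis .
qed

lemma num_drop_conv:
  assumes s: "s permutes {1..n}"
  shows "num_drop n s = num_cpk n s + num_cdd n s"
proof -
  have ne: "inv s i < i \<or> i < inv s i" if "s i < i" for i
    using permutes_inverses(1)[OF s, of i] that by (cases "inv s i = i") auto
  have "{i \<in> {1..n}. i > s i}
      = {i \<in> {1..n}. inv s i < i \<and> i > s i} \<union> {i \<in> {1..n}. inv s i > i \<and> i > s i}"
    using ne by blast
  then have "num_drop n s = card \<dots>" by (simp add: num_drop_def)
  also have "\<dots> = num_cpk n s + num_cdd n s"
    unfolding num_cpk_def num_cdd_def by (rule card_Un_disjoint) auto
  finally show ?thesis .
qed

section \<open>The two expansions of the cycle Eulerian polynomial\<close>

theorem theorem1p1:
  fixes n :: nat
    and x y u1 u2 u3 u4 t \<alpha> :: "'a::comm_ring_1"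
  assumes "n \<ge> 1"
    and "x * y = u1 * u2"
    and "x + y = u3 + u4"
  shows "cyc_eulerian n x y t \<alpha> =
    (\<Sum>s | s permutes {1..n}.
      (u1 * u2) ^ num_cpk n s * u3 ^ num_cda n s * u4 ^ num_cdd n s
        * t ^ num_fix n s * \<alpha> ^ num_cyc n s)"
proof -
  define W where "W k p q f l = (x * y) ^ k * (x ^ p * y ^ q - u3 ^ p * u4 ^ q) * t ^ f * \<alpha> ^ l"
    for k p q f l
  have "binomially_null W"
    unfolding binomially_null_def
  proof (intro allI)
    fix k m f l
    have "(\<Sum>p\<le>m. of_nat (m choose p) * W k p (m - p) f l)
        = (\<Sum>p\<le>m. (x * y) ^ k * t ^ f * \<alpha> ^ l *
            (of_nat (m choose p) * x ^ p * y ^ (m - p) - of_nat (m choose p) * u3 ^ p * u4 ^ (m - p)))"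
      by (intro sum.cong refl) (simp add: W_def algebra_simps)
    also have "\<dots> = (x * y) ^ k * t ^ f * \<alpha> ^ l * ((x + y) ^ m - (u3 + u4) ^ m)"
      by (simp only: binomial_ring sum_subtractf flip: sum_distrib_left)
    finally show "(\<Sum>p\<le>m. of_nat (m choose p) * W k p (m - p) f l) = 0"
      using assms(3) by simp
  qed
  then have "(\<Sum>s | s permutes {1..n}. weigh_stats W n s) = 0"
    by (rule sum_weigh_stats_eq_0)
  moreover have "weigh_stats W n s =
      x ^ num_exc n s * y ^ num_drop n s * t ^ num_fix n s * \<alpha> ^ num_cyc n s
      - (u1 * u2) ^ num_cpk n s * u3 ^ num_cda n s * u4 ^ num_cdd n s
        * t ^ num_fix n s * \<alpha> ^ num_cyc n s" if "s permutes {1..n}" for s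
    unfolding num_exc_conv[OF that] num_drop_conv[OF that] assms(2)[symmetric] weigh_stats_def W_def
    by (simp add: power_add power_mult_distrib algebra_simps)
  ultimately show ?thesis
    by (simp add: cyc_eulerian_def sum_subtractf)
qed

end
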